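(* For a non-zero real $2\times 2$ matrix $B$ and vectors $d,v\in\mathbb{R}^2$, where $Bv+d$ is not an eigenvector of $B$, let $c:\mathbb{R}\to\mathbb{R}^2$ be the solution of the differential equation $\dot c(t)=Bc(t)+d$, $c(0)=v$, i.e. $c(t)=v+F_B(t)(Bv+d)=\exp(tB)(v)+F_B(t)(d)$. Assume that $$\beta=\left|\dot c(0)\ \ \ddot c(0)\right|^{1/3}=\left|Bv+d\ \ \ B(Bv+d)\right|^{1/3}>0 .$$ Define $$k=k(B)=-2+\frac{9\det(B)}{(\operatorname{tr}B)^2},\qquad K=K(B)=|k(B)|^{-1/2}.$$ (a) If $\operatorname{tr}(B)=0$, then the curve is parametrized proportional to equi-affine arc length, the equi-affine curvature is constant, $k_{ea}=\det(B)/\beta^2$, and $\epsilon=\operatorname{sign}(\det(B))$; the curve is a parabola if $\epsilon=0$, an ellipse if $\epsilon>0$, or a hyperbola if $\epsilon<0$. (b) If $\operatorname{tr}(B)\neq0$, then one can choose a parametrization by equi-affine arc length $s_{ea}$ such that the equi-affine curvature $k_{ea}$ is given by $$k_{ea}(s_{ea})=k(B)\,s_{ea}^{-2}.$$ If $k(B)=0$, the curve has vanishing equi-affine curvature and is a parametrization of a parabola. If $k(B)\neq0$, then the general-affine curvature is defined and constant: $$k_{ga}(s_{ea})=-2K(B).$$ Up to an additive constant the general-affine arc length parameter $s_{ga}$ is given by $$s_{ga}=\frac{\operatorname{tr}B}{3K(B)}\,t .$$ Hence the curve $c(t)$ is parametrized proportional to general-affine arc length.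
   Context: For a real square matrix $B$ and $t\in\mathbb{R}$, $F_B(t)=\sum_{k=1}^\infty\frac{t^k}{k!}B^{k-1}$. For $x,y\in\mathbb{R}^2$, $|x\ \ y|$ denotes the determinant of the matrix with columns $x,y$. Let $c:I\to\mathbb{R}^2$ be a smooth plane curve with $|\dot c(t)\ \ \ddot c(t)|>0$ for all $t\in I$. Its equi-affine arc length is $s_{ea}(t)=\int|\dot c(t)\ \ \ddot c(t)|^{1/3}\,dt$. With $t=t(s_{ea})$ the inverse function, $\tilde c(s_{ea})=c(t(s_{ea}))$ is the parametrization by equi-affine arc length. Then $\tilde c'''$ and $\tilde c'$ are linearly dependent, and the equi-affine curvature $k_{ea}$ is defined by $\tilde c'''(s_{ea})=-k_{ea}(s_{ea})\,\tilde c'(s_{ea})$, respectively $k_{ea}=|\tilde c''\ \ \tilde c'''|$. The curve $c$ is parametrized proportional to equi-affine arc length if $t=\lambda_1s_{ea}+\lambda_2$ for constants $\lambda_1\neq0$, $\lambda_2\in\mathbb{R}$. The symbol $\epsilon=\operatorname{sign}(k_{ea})\in\{0,\pm1\}$ denotes the sign of the equi-affine curvature when this sign is constant. Suppose $\epsilon$ is constant and non-zero, and let $K_{ea}=|k_{ea}|=\epsilon k_{ea}$. The general-affine arc length is defined by $s_{ga}=\int\sqrt{K_{ea}(s_{ea})}\,ds_{ea}$, and the general-affine curvature by $$k_{ga}=K_{ea}'\,K_{ea}^{-3/2}=-2\left(K_{ea}^{-1/2}\right)',$$ where $'$ is differentiation with respect to $s_{ea}$. The curve $c$ is parametrized proportional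 to general-affine arc length if $t=\lambda_1s_{ga}+\lambda_2$ for constants $\lambda_1\neq0$, $\lambda_2\in\mathbb{R}$.
   Formalization: For tr B < 0 and s_ea increasing in t, the formulas for k_ga and s_ga have the wrong sign: then k_ga = 2K(B), s_ga = |tr B| t/(3K(B)) up to a constant. The stated formulas are proved with s_ea directed against t when tr B < 0. *)

theory Defs
  imports "HOL-Analysis.Analysis"
begin

definition col_det :: "real^2 \<Rightarrow> real^2 \<Rightarrow> real" where
  "col_det x y = det (\<chi> i j. (if j = 1 then x else y) $ i)"

definition eigenvector_of :: "real^2^2 \<Rightarrow> real^2 \<Rightarrow> bool" where
  "eigenvector_of B x \<longleftrightarrow> x \<noteq> 0 \<and> (\<exists>l. B *v x = l *\<^sub>R x)"

primrec mat_power :: "real^2^2 \<Rightarrow> nat \<Rightarrow> real^2^2" where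
  "mat_power B 0 = mat 1"
| "mat_power B (Suc n) = B ** mat_power B n"

definition mat_exp :: "real^2^2 \<Rightarrow> real^2^2" where
  "mat_exp B = (\<Sum>n. (1 / fact n) *\<^sub>R mat_power B n)"

text \<open>The series \<open>t^k / k! B^(k-1)\<close> over \<open>k \<ge> 1\<close>, with \<open>k = Suc n\<close>.\<close>
definition F_mat :: "real^2^2 \<Rightarrow> real \<Rightarrow> real^2^2" where
  "F_mat B t = (\<Sum>n. (t ^ Suc n / fact (Suc n)) *\<^sub>R mat_power B n)"

definition affine_k :: "real^2^2 \<Rightarrow> real" where
  "affine_k B = -2 + 9 * det B / (trace B)\<^sup>2"

definition affine_K :: "real^2^2 \<Rightarrow> real" where
  "affine_K B = \<bar>affine_k B\<bar> powr (-1/2)"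

definition curve_deriv :: "(real \<Rightarrow> real^2) \<Rightarrow> real \<Rightarrow> real^2" where
  "curve_deriv c t = vector_derivative c (at t)"

definition smooth_curve :: "(real \<Rightarrow> real^2) \<Rightarrow> real set \<Rightarrow> bool" where
  "smooth_curve c I \<longleftrightarrow> open I \<and> is_interval I \<and> I \<noteq> {} \<and>
     (\<forall>n. \<forall>t\<in>I. (curve_deriv ^^ n) c differentiable (at t))"

definition positively_curved :: "(real \<Rightarrow> real^2) \<Rightarrow> real set \<Rightarrow> bool" where
  "positively_curved c I \<longleftrightarrow> smooth_curve c I \<and>
     (\<forall>t\<in>I. col_det (curve_deriv c t) (curve_deriv (curve_deriv c) t) > 0)"

text \<open>The arc length is an indefinite integral, hence a relation: \<open>s\<close> is determined on an
  interval \<open>I\<close> up to an additive constant.\<close>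
definition ea_arc_length ::
  "(real \<Rightarrow> real^2) \<Rightarrow> real set \<Rightarrow> (real \<Rightarrow> real) \<Rightarrow> bool" where
  "ea_arc_length c I s \<longleftrightarrow>
     (\<forall>t\<in>I. (s has_real_derivative
        root 3 (col_det (curve_deriv c t) (curve_deriv (curve_deriv c) t))) (at t))"

definition reparam :: "(real \<Rightarrow> real^2) \<Rightarrow> real set \<Rightarrow> (real \<Rightarrow> real) \<Rightarrow> real \<Rightarrow> real^2" where
  "reparam c I s \<sigma> = c (the_inv_into I s \<sigma>)"

text \<open>The curvature is a function of the parameter \<open>\<sigma>\<close> in \<open>s ` I\<close>. Its defining equation is
  unaffected by replacing \<open>\<sigma>\<close> by \<open>-\<sigma>\<close>, whereas the determinant of the second and
  third derivative of the reparametrized curve changes its sign.\<close>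
definition ea_curvature ::
  "(real \<Rightarrow> real^2) \<Rightarrow> real set \<Rightarrow> (real \<Rightarrow> real) \<Rightarrow> real \<Rightarrow> real" where
  "ea_curvature c I s \<sigma> =
     (THE k. (curve_deriv ^^ 3) (reparam c I s) \<sigma> = - k *\<^sub>R curve_deriv (reparam c I s) \<sigma>)"

definition proportional_to_ea_arc_length :: "(real \<Rightarrow> real^2) \<Rightarrow> real set \<Rightarrow> bool" where
  "proportional_to_ea_arc_length c I \<longleftrightarrow>
     (\<exists>s l1 l2. ea_arc_length c I s \<and> l1 \<noteq> 0 \<and> (\<forall>t\<in>I. t = l1 * s t + l2))"

definition has_ea_sign :: "(real \<Rightarrow> real^2) \<Rightarrow> real set \<Rightarrow> real \<Rightarrow> bool" where
  "has_ea_sign c I \<epsilon> \<longleftrightarrow>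
     (\<exists>s. ea_arc_length c I s \<and> (\<forall>\<sigma>\<in>s ` I. sgn (ea_curvature c I s \<sigma>) = \<epsilon>))"

definition abs_ea_curvature ::
  "(real \<Rightarrow> real^2) \<Rightarrow> real set \<Rightarrow> (real \<Rightarrow> real) \<Rightarrow> real \<Rightarrow> real" where
  "abs_ea_curvature c I s \<sigma> = \<bar>ea_curvature c I s \<sigma>\<bar>"

definition ga_defined :: "(real \<Rightarrow> real^2) \<Rightarrow> real set \<Rightarrow> bool" where
  "ga_defined c I \<longleftrightarrow> positively_curved c I \<and> (\<exists>\<epsilon>. \<epsilon> \<noteq> 0 \<and> has_ea_sign c I \<epsilon>)"

text \<open>The general-affine arc length \<open>g\<close> is given as a function of the original parameter \<open>t\<close>
  of the curve; \<open>G\<close> is the same quantity as a function of the equi-affine arc length.\<close>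
definition ga_arc_length ::
  "(real \<Rightarrow> real^2) \<Rightarrow> real set \<Rightarrow> (real \<Rightarrow> real) \<Rightarrow> (real \<Rightarrow> real) \<Rightarrow> bool" where
  "ga_arc_length c I s g \<longleftrightarrow>
     (\<exists>G. (\<forall>\<sigma>\<in>s ` I. (G has_real_derivative sqrt (abs_ea_curvature c I s \<sigma>)) (at \<sigma>)) \<and>
          (\<forall>t\<in>I. g t = G (s t)))"

definition ga_curvature ::
  "(real \<Rightarrow> real^2) \<Rightarrow> real set \<Rightarrow> (real \<Rightarrow> real) \<Rightarrow> real \<Rightarrow> real" where
  "ga_curvature c I s \<sigma> =
     deriv (abs_ea_curvature c I s) \<sigma> * abs_ea_curvature c I s \<sigma> powr (-3/2)"

definition proportional_to_ga_arc_length :: "(real \<Rightarrow> real^2) \<Rightarrow> real set \<Rightarrow> bool" where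
  "proportional_to_ga_arc_length c I \<longleftrightarrow>
     (\<exists>s g l1 l2. ea_arc_length c I s \<and> ga_arc_length c I s g \<and> l1 \<noteq> 0 \<and>
        (\<forall>t\<in>I. t = l1 * g t + l2))"

text \<open>Conics as images of \<open>y = x\<^sup>2\<close>, \<open>x\<^sup>2 + y\<^sup>2 = 1\<close> and \<open>x\<^sup>2 - y\<^sup>2 = 1\<close>
  under affine automorphisms of the plane.\<close>
definition parabola :: "(real^2) set \<Rightarrow> bool" where
  "parabola P \<longleftrightarrow> (\<exists>p a b. col_det a b \<noteq> 0 \<and>
     P = {p + x *\<^sub>R a + y *\<^sub>R b | x y. y = x\<^sup>2})"

definition ellipse :: "(real^2) set \<Rightarrow> bool" where
  "ellipse E \<longleftrightarrow> (\<exists>p a b. col_det a b \<noteq> 0 \<and>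
     E = {p + x *\<^sub>R a + y *\<^sub>R b | x y. x\<^sup>2 + y\<^sup>2 = 1})"

definition hyperbola :: "(real^2) set \<Rightarrow> bool" where
  "hyperbola H \<longleftrightarrow> (\<exists>p a b. col_det a b \<noteq> 0 \<and>
     H = {p + x *\<^sub>R a + y *\<^sub>R b | x y. x\<^sup>2 - y\<^sup>2 = 1})"

text \<open>An injective parametrization of a (possibly proper) open arc of \<open>P\<close>: the curve
  \<open>(exp t, exp (2 * t))\<close>, for instance, traces only the half \<open>x > 0\<close> of the parabola
  \<open>y = x\<^sup>2\<close>.\<close>
definition parametrizes_arc_of :: "(real \<Rightarrow> real^2) \<Rightarrow> real set \<Rightarrow> (real^2) set \<Rightarrow> bool" where
  "parametrizes_arc_of c I P \<longleftrightarrow> smooth_curve c I \<and> (\<forall>t\<in>I. curve_deriv c t \<noteq> 0) \<and>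
     inj_on c I \<and> openin (top_of_set P) (c ` I)"

end

theory Submission
  imports Defs
begin

text \<open>The velocity \<open>u = B c + d\<close> satisfies \<open>u' = B u\<close>, so by Cayley--Hamilton
  \<open>|u  B u|' = tr B |u  B u|\<close>. Hence the derivative of the equi-affine arc length is
  \<open>h(t) = \<beta> exp (tr B t / 3)\<close>, and differentiating \<open>u / h\<close> with Cayley--Hamilton once more gives
  \<open>k_ea = (det B - 2 (tr B)\<^sup>2 / 9) / h\<^sup>2\<close>. If \<open>tr B \<noteq> 0\<close>, then \<open>3 h / tr B\<close> is itself an arc length
  parameter, which turns this into \<open>k(B) s_ea\<^sup>-\<^sup>2\<close>. The conics are read off from the solution
  \<open>c(t) = c(0) + f1(t) u(0) + f2(t) B u(0)\<close> with \<open>f1' = 1 - det B f2\<close>, \<open>f2' = f1 + tr B f2\<close>.\<close>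

section \<open>Planar determinants and Cayley--Hamilton\<close>

lemma col_det_eq: "col_det x y = x $ 1 * y $ 2 - y $ 1 * x $ 2"
  by (simp add: col_det_def det_2)

lemma col_det_simps [simp]:
  "col_det x x = 0" "col_det 0 y = 0" "col_det x 0 = 0"
  "col_det (a *\<^sub>R x) y = a * col_det x y" "col_det x (a *\<^sub>R y) = a * col_det x y"
  "col_det (- x) y = - col_det x y" "col_det x (- y) = - col_det x y"
  "col_det (x + x') y = col_det x y + col_det x' y"
  "col_det x (y + y') = col_det x y + col_det x y'"
  "col_det (x - x') y = col_det x y - col_det x' y"
  "col_det x (y - y') = col_det x y - col_det x y'"
  by (simp_all add: col_det_eq algebra_simps)

lemma col_det_swap: "col_det y x = - col_det x y"
  by (simp add: col_det_eq)

lemma bounded_bilinear_col_det: "bounded_bilinear col_det"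
proof -
  have "bilinear col_det"
    by (auto simp: bilinear_def linear_iff)
  then show ?thesis
    by (simp add: bilinear_conv_bounded_bilinear)
qed

lemma Cayley_Hamilton_2:
  fixes B :: "real^2^2"
  shows "B *v (B *v x) = trace B *\<^sub>R (B *v x) - det B *\<^sub>R x"
  by (simp add: vec_eq_iff forall_2 matrix_vector_mult_def sum_2 det_2 trace_def algebra_simps)

section \<open>Matrix powers and the series for F_B and exp\<close>

lemma bounded_linear_matrix_vector_mult_left:
  "bounded_linear (\<lambda>A::real^'n^'m. A *v x)"
proof -
  have "linear (\<lambda>A::real^'n^'m. A *v x)"
    by (simp add: linear_iff matrix_vector_mult_add_rdistrib scaleR_matrix_vector_assoc)
  then show ?thesis
    by (simp add: linear_conv_bounded_linear)
qed

text \<open>\<open>mat_power\<close> multiplies by \<open>B\<close> on the left, whereas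
  differentiating \<open>mat_power B n *v u t\<close> along the flow produces a \<open>B\<close> on
  the right.\<close>

lemma mat_power_commute: "mat_power B n ** B = B ** mat_power B n"
  by (induction n) (simp_all add: matrix_mul_assoc [symmetric])

lemma mat_power_scaleR: "mat_power (t *\<^sub>R B) n = t ^ n *\<^sub>R mat_power B n"
proof (induction n)
  case (Suc n)
  then show ?case
    by (simp add: vec_eq_iff matrix_matrix_mult_def sum_distrib_left mult_ac)
qed auto

text \<open>The norm on \<open>real^2^2\<close> is Euclidean in the entries and not the operator
  norm, so geometric growth is first established for the action on vectors.\<close>

lemma norm_mat_power_bound:
  obtains K where "K \<ge> 0" "\<And>n x. norm (mat_power B n *v x) \<le> K ^ n * norm x"
proof -
  obtain K where K: "K > 0" "\<And>x. norm (B *v x) \<le> norm x * K"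
    using bounded_linear.pos_bounded [OF matrix_vector_mul_bounded_linear [of B]] by auto
  have "norm (mat_power B n *v x) \<le> K ^ n * norm x" for n x
  proof (induction n)
    case (Suc n)
    have "norm (mat_power B (Suc n) *v x) = norm (B *v (mat_power B n *v x))"
      by (simp add: matrix_vector_mul_assoc)
    also have "\<dots> \<le> norm (mat_power B n *v x) * K"
      by (rule K)
    also have "\<dots> \<le> (K ^ n * norm x) * K"
      using Suc K(1) by (intro mult_right_mono) auto
    finally show ?case
      by (simp add: mult_ac)
  qed auto
  with K(1) that show thesis
    by (meson less_imp_le)
qed

text \<open>Carries bounds on the images of the basis vectors over to the matrix norm. One norm per
  entry is generous, but only a constant factor is at stake.\<close>

lemma norm_matrix_le_sum_columns:
  fixes A :: "real^'n^'m"
  shows "norm A \<le> (\<Sum>i\<in>(UNIV::'m set). \<Sum>j\<in>UNIV. norm (A *v axis j 1))"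
proof -
  have "norm A \<le> (\<Sum>i\<in>UNIV. norm (A $ i))"
    unfolding norm_vec_def by (rule L2_set_le_sum) auto
  also have "\<dots> \<le> (\<Sum>i\<in>UNIV. \<Sum>j\<in>UNIV. \<bar>A $ i $ j\<bar>)"
    by (intro sum_mono norm_le_l1_cart)
  also have "\<dots> \<le> (\<Sum>i\<in>(UNIV::'m set). \<Sum>j\<in>UNIV. norm (A *v axis j 1))"
  proof (intro sum_mono)
    fix i j
    have "A $ i $ j = (A *v axis j 1) $ i"
      by (simp add: matrix_vector_mult_basis column_def)
    then show "\<bar>A $ i $ j\<bar> \<le> norm (A *v axis j 1)"
      by (metis component_le_norm_cart)
  qed
  finally show ?thesis .
qed

lemma summable_F_mat: "summable (\<lambda>n. (t ^ Suc n / fact (Suc n)) *\<^sub>R mat_power B n)"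
proof -
  obtain K where K: "K \<ge> 0" "\<And>n x. norm (mat_power B n *v x) \<le> K ^ n * norm x"
    using norm_mat_power_bound by metis
  \<comment> \<open>The factor 4 counts the entries, each of which contributes one
    \<open>K ^ n\<close>.\<close>
  have mp: "norm (mat_power B n) \<le> 4 * K ^ n" for n
  proof -
    have "norm (mat_power B n) \<le> (\<Sum>i\<in>(UNIV::2 set). \<Sum>j\<in>(UNIV::2 set). K ^ n)"
      by (rule order_trans [OF norm_matrix_le_sum_columns]) (intro sum_mono, use K(2)[of n "axis _ 1"] in simp)
    then show ?thesis
      by (simp add: sum_2)
  qed
  \<comment> \<open>The majorant is the exponential series at \<open>\<bar>t\<bar> * K\<close>; the
    extra factor \<open>\<bar>t\<bar>\<close> and the weakening of \<open>fact (Suc n)\<close> to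
    \<open>fact n\<close> absorb the index shift.\<close>
  have "summable (\<lambda>n. (4 * \<bar>t\<bar>) * (inverse (fact n) * (\<bar>t\<bar> * K) ^ n))"
    by (intro summable_mult summable_exp)
  then show ?thesis
  proof (rule summable_comparison_test' [where N = 0])
    fix n
    have "norm ((t ^ Suc n / fact (Suc n)) *\<^sub>R mat_power B n)
        \<le> (\<bar>t\<bar> ^ Suc n / fact (Suc n)) * (4 * K ^ n)"
      using mp[of n] by (simp add: power_abs abs_mult mult_left_mono divide_right_mono del: fact_Suc)
    also have "\<dots> \<le> (\<bar>t\<bar> ^ Suc n / fact n) * (4 * K ^ n)"
      using K(1) by (intro mult_right_mono divide_left_mono fact_mono) auto
    also have "\<dots> = (4 * \<bar>t\<bar>) * (inverse (fact n) * (\<bar>t\<bar> * K) ^ n)"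
      by (simp add: field_simps)
    finally show "norm ((t ^ Suc n / fact (Suc n)) *\<^sub>R mat_power B n)
        \<le> (4 * \<bar>t\<bar>) * (inverse (fact n) * (\<bar>t\<bar> * K) ^ n)" .
  qed
qed

lemma F_mat_vector_sums:
  "(\<lambda>n. (t ^ Suc n / fact (Suc n)) *\<^sub>R (mat_power B n *v x)) sums (F_mat B t *v x)"
  using bounded_linear.sums [OF bounded_linear_matrix_vector_mult_left
      summable_sums [OF summable_F_mat]]
  unfolding F_mat_def by (simp add: scaleR_matrix_vector_assoc)

text \<open>Splitting the constant term off the exponential series leaves the series of
  \<open>F_mat B t\<close> with one more factor \<open>B\<close> in each term. This links the two
  forms of the solution.\<close>

lemma mat_exp_eq_F_mat: "mat_exp (t *\<^sub>R B) *v x = x + F_mat B t *v (B *v x)"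
proof -
  let ?f = "\<lambda>n. ((1 / fact n) *\<^sub>R mat_power (t *\<^sub>R B) n) *v x"
  have f: "?f n = (t ^ n / fact n) *\<^sub>R (mat_power B n *v x)" for n
    by (simp add: mat_power_scaleR scaleR_matrix_vector_assoc)
  have "(\<lambda>n. ?f (Suc n)) sums (F_mat B t *v (B *v x))"
    using F_mat_vector_sums [of t B "B *v x"] unfolding f
    by (simp add: matrix_vector_mul_assoc mat_power_commute del: power_Suc fact_Suc)
  then have v: "?f sums (F_mat B t *v (B *v x) + x)"
    using sums_Suc [of ?f] by simp
  \<comment> \<open>Left multiplication by \<open>B\<close> turns the convergent series of
    \<open>F_mat\<close> into the tail of the exponential series.\<close>
  have "summable (\<lambda>n. (1 / fact n) *\<^sub>R mat_power (t *\<^sub>R B) n)"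
  proof -
    have lin: "linear (\<lambda>A. B ** A)"
      by (simp add: linear_iff vec_eq_iff matrix_matrix_mult_def sum_2 algebra_simps)
    from lin have "bounded_linear (\<lambda>A. B ** A)"
      by (simp only: linear_conv_bounded_linear)
    from bounded_linear.summable [OF this summable_F_mat [of t B]]
    have "summable (\<lambda>n. (t ^ Suc n / fact (Suc n)) *\<^sub>R mat_power B (Suc n))"
      unfolding mat_power.simps linear_cmul [OF lin] .
    then show ?thesis
      by (subst summable_Suc_iff [symmetric]) (simp add: mat_power_scaleR del: power_Suc fact_Suc mat_power.simps)
  qed
  then have "?f sums (mat_exp (t *\<^sub>R B) *v x)"
    unfolding mat_exp_def
    by (rule bounded_linear.sums [OF bounded_linear_matrix_vector_mult_left summable_sums])
  from sums_unique2 [OF this v] show ?thesis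
    by (simp only: add.commute)
qed

section \<open>Solutions of the affine differential equation\<close>

lemma has_vector_derivative_matrix_vector_mult:
  fixes A :: "real^'n^'m"
  assumes "(f has_vector_derivative f') F"
  shows "((\<lambda>t. A *v f t) has_vector_derivative (A *v f')) F"
  by (rule bounded_linear.has_vector_derivative [OF matrix_vector_mul_bounded_linear assms])

lemma has_real_derivative_component:
  fixes f :: "real \<Rightarrow> real^2"
  assumes "(f has_vector_derivative f') F"
  shows "((\<lambda>t. f t $ i) has_real_derivative f' $ i) F"
  using bounded_linear.has_vector_derivative [OF bounded_linear_vec_nth assms]
  by (simp add: has_real_derivative_iff_has_vector_derivative)

text \<open>Taylor's formula is applied to each component of an arbitrary solution. The derivative
  of order \<open>n + 1\<close> is \<open>B^n u\<close>, so the Lagrange remainder is dominated by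
  terms of an exponential series and tends to 0. Hence the solution equals its Taylor series, and
  uniqueness follows as well.\<close>

lemma affine_flow_solution:
  fixes B :: "real^2^2"
  assumes flow: "\<And>t. (c has_vector_derivative (B *v c t + d)) (at t)"
  shows "c t = c 0 + F_mat B t *v (B *v c 0 + d)"
proof -
  define u where "u t = B *v c t + d" for t
  have du: "((\<lambda>t. mat_power B n *v u t) has_vector_derivative (mat_power B (Suc n) *v u t)) (at t)"
    for n t
  proof -
    have "(u has_vector_derivative (B *v u t)) (at t)"
      unfolding u_def
      using has_vector_derivative_add [OF has_vector_derivative_matrix_vector_mult [OF flow, of B]
          has_vector_derivative_const]
      by simp
    from has_vector_derivative_matrix_vector_mult [OF this, of "mat_power B n"]
    show ?thesis
      by (simp add: matrix_vector_mul_assoc mat_power_commute)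
  qed
  obtain K where K: "K \<ge> 0" "\<And>n x. norm (mat_power B n *v x) \<le> K ^ n * norm x"
    using norm_mat_power_bound by metis
  \<comment> \<open>A bound for \<open>u\<close> on this compact interval serves every remainder at
    once, since the intermediate point of Taylor's formula satisfies
    \<open>\<bar>x\<bar> \<le> \<bar>t\<bar>\<close>.\<close>
  have "continuous_on {-\<bar>t\<bar>..\<bar>t\<bar>} u"
    using du[of 0] by (auto simp: has_vector_derivative_def intro!: has_derivative_continuous_on
        intro: has_derivative_at_withinI)
  then have "bounded (u ` {-\<bar>t\<bar>..\<bar>t\<bar>})"
    by (intro compact_imp_bounded compact_continuous_image) auto
  then obtain U where U: "\<And>x. \<bar>x\<bar> \<le> \<bar>t\<bar> \<Longrightarrow> norm (u x) \<le> U"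
    by (fastforce simp: bounded_iff abs_le_iff minus_le_iff)
  have U0: "U \<ge> 0"
    using U[of t] norm_ge_zero order_trans by blast
  have comp: "(F_mat B t *v u 0) $ i = c t $ i - c 0 $ i" for i
  proof -
    \<comment> \<open>The index is shifted: order 0 is the curve itself, and only from order 1 on do
      powers of \<open>B\<close> act on the velocity, so the inhomogeneity \<open>d\<close> enters
      only through \<open>u\<close>.\<close>
    define diff where "diff m t = (case m of 0 \<Rightarrow> c t $ i | Suc n \<Rightarrow> (mat_power B n *v u t) $ i)" for m t
    have diff_0: "diff 0 = (\<lambda>t. c t $ i)"
      by (simp add: diff_def [abs_def])
    have diff: "DERIV (diff m) x :> diff (Suc m) x" for m x
    proof (cases m)
      case 0
      then show ?thesis
        using has_real_derivative_component [OF flow [of x], of i]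
        by (simp add: diff_def [abs_def] u_def)
    next
      case (Suc n)
      then show ?thesis
        using has_real_derivative_component [OF du [of n x], of i] by (simp add: diff_def [abs_def])
    qed
    let ?P = "\<lambda>n. \<Sum>m<n. (t ^ Suc m / fact (Suc m)) * (mat_power B m *v u 0) $ i"
    let ?e = "\<lambda>n. (U * \<bar>t\<bar>) * (inverse (fact n) * (\<bar>t\<bar> * K) ^ n)"
    have est: "norm (c t $ i - c 0 $ i - ?P n) \<le> ?e n" for n
    proof -
      obtain x where x: "\<bar>x\<bar> \<le> \<bar>t\<bar>"
        "c t $ i = (\<Sum>m<Suc n. (diff m 0 / fact m) * t ^ m) + (diff (Suc n) x / fact (Suc n)) * t ^ Suc n"
        using Maclaurin_all_le [of diff "\<lambda>t. c t $ i" t "Suc n"] diff diff_0 by blast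
      have "(\<Sum>m<Suc n. (diff m 0 / fact m) * t ^ m) = c 0 $ i + ?P n"
        unfolding sum.lessThan_Suc_shift by (simp add: diff_def mult_ac del: fact_Suc)
      with x(2) have "norm (c t $ i - c 0 $ i - ?P n) = \<bar>(mat_power B n *v u x) $ i\<bar> / fact (Suc n) * \<bar>t\<bar> ^ Suc n"
        by (simp add: diff_def abs_mult power_abs del: fact_Suc)
      also have "\<dots> \<le> (K ^ n * U) / fact n * \<bar>t\<bar> ^ Suc n"
      proof (intro mult_right_mono frac_le)
        show "\<bar>(mat_power B n *v u x) $ i\<bar> \<le> K ^ n * U"
          using component_le_norm_cart [of "mat_power B n *v u x" i] K(2)[of n "u x"]
            mult_left_mono [OF U [OF x(1)], of "K ^ n"] K(1) by (auto intro: order_trans)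
      qed (use K(1) U0 in \<open>auto intro: fact_mono simp del: fact_Suc\<close>)
      also have "\<dots> = ?e n"
        by (simp add: field_simps)
      finally show ?thesis .
    qed
    have "?e \<longlonglongrightarrow> 0"
      by (intro tendsto_mult_right_zero summable_LIMSEQ_zero summable_exp)
    then have "(\<lambda>n. c t $ i - c 0 $ i - ?P n) \<longlonglongrightarrow> 0"
      by (rule Lim_null_comparison [rotated]) (intro always_eventually allI est)
    from tendsto_diff [OF tendsto_const [of "c t $ i - c 0 $ i"] this]
    have "?P \<longlonglongrightarrow> c t $ i - c 0 $ i"
      by simp
    moreover have "?P \<longlonglongrightarrow> (F_mat B t *v u 0) $ i"
      using bounded_linear.sums [OF bounded_linear_vec_nth F_mat_vector_sums [of t B "u 0"], of i]
      by (simp add: sums_def del: fact_Suc power_Suc)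
    ultimately show ?thesis
      by (rule LIMSEQ_unique [symmetric])
  qed
  show ?thesis
    using comp by (simp add: vec_eq_iff u_def)
qed

text \<open>The series depends only on the initial value. Closed forms of the curve can therefore be
  verified by checking the differential equation.\<close>

corollary affine_flow_unique:
  fixes B :: "real^2^2"
  assumes "\<And>t. (c has_vector_derivative (B *v c t + d)) (at t)"
    and "\<And>t. (e has_vector_derivative (B *v e t + d)) (at t)"
    and "c 0 = e 0"
  shows "c = e"
proof
  show "c t = e t" for t
    using affine_flow_solution [OF assms(1), of t] affine_flow_solution [OF assms(2), of t] assms(3)
    by simp
qed

section \<open>Velocity and equi-affine speed of the flow\<close>

lemma curve_deriv_eqI:
  "(f has_vector_derivative D) (at t) \<Longrightarrow> curve_deriv f t = D"
  by (simp add: curve_deriv_def vector_derivative_at)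

locale affine_flow =
  fixes B :: "real^2^2" and d :: "real^2" and c :: "real \<Rightarrow> real^2" and \<beta> :: real
  assumes flow: "(c has_vector_derivative (B *v c t + d)) (at t)"
    and \<beta>_eq: "\<beta> = root 3 (col_det (B *v c 0 + d) (B *v (B *v c 0 + d)))"
    and \<beta>_pos: "\<beta> > 0"
begin

definition u :: "real \<Rightarrow> real^2" where "u t = B *v c t + d"

definition h :: "real \<Rightarrow> real" where "h t = \<beta> * exp (trace B / 3 * t)"

lemma has_vector_derivative_c: "(c has_vector_derivative u t) (at t)"
  unfolding u_def by (rule flow)

lemma has_vector_derivative_u: "(u has_vector_derivative (B *v u t)) (at t)"
  unfolding u_def [abs_def]
  using has_vector_derivative_add [OF has_vector_derivative_matrix_vector_mult [OF flow, of B]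
      has_vector_derivative_const]
  by simp

lemma has_vector_derivative_mat_u:
  "((\<lambda>t. A *v u t) has_vector_derivative (A *v (B *v u t))) (at t)"
  by (intro has_vector_derivative_matrix_vector_mult has_vector_derivative_u)

lemma curve_deriv_c: "curve_deriv c = u"
  by (rule ext, rule curve_deriv_eqI, rule has_vector_derivative_c)

lemma curve_deriv_u: "curve_deriv u t = B *v u t"
  by (rule curve_deriv_eqI, rule has_vector_derivative_u)

lemma curve_deriv_funpow_Suc: "(curve_deriv ^^ Suc n) c = (\<lambda>t. mat_power B n *v u t)"
proof (induction n)
  case 0
  show ?case
    by (simp add: curve_deriv_c)
next
  case (Suc n)
  have "curve_deriv (\<lambda>t. mat_power B n *v u t) t = mat_power B (Suc n) *v u t" for t
    by (rule curve_deriv_eqI)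
      (use has_vector_derivative_mat_u [of "mat_power B n" t] in
        \<open>simp add: matrix_vector_mul_assoc mat_power_commute\<close>)
  with Suc show ?case
    by auto
qed

lemma smooth_curve_c: "smooth_curve c UNIV"
proof -
  have "(curve_deriv ^^ n) c differentiable (at t)" for n t
  proof (cases n)
    case 0
    then show ?thesis
      using has_vector_derivative_c [of t] by (auto intro: differentiableI_vector)
  next
    case (Suc m)
    then show ?thesis
      using differentiableI_vector [OF has_vector_derivative_mat_u [of "mat_power B m" t]]
      by (simp only: curve_deriv_funpow_Suc)
  qed
  then show ?thesis
    by (auto simp: smooth_curve_def)
qed

lemma h_pos [simp]: "h t > 0"
  using \<beta>_pos by (simp add: h_def)

lemma h_nonzero [simp]: "h t \<noteq> 0"
  using h_pos [of t] by linarith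

lemma DERIV_h: "(h has_real_derivative (trace B / 3 * h t)) (at t)"
  unfolding h_def by (auto intro!: derivative_eq_intros)

text \<open>The determinant \<open>D\<close> of \<open>u\<close> and \<open>B u\<close> satisfies
  \<open>D' = tr B * D\<close>, because the \<open>det B\<close> term of Cayley--Hamilton is killed
  by \<open>col_det x x = 0\<close>. With the integrating factor \<open>exp (- tr B * t)\<close> it
  becomes constant, and its initial value is \<open>\<beta> ^ 3\<close>.\<close>

lemma col_det_u: "col_det (u t) (B *v u t) = h t ^ 3"
proof -
  let ?f = "\<lambda>t. col_det (u t) (B *v u t) * exp (- trace B * t)"
  have D: "((\<lambda>t. col_det (u t) (B *v u t)) has_real_derivative
      (trace B * col_det (u t) (B *v u t))) (at t)" for t
    using bounded_bilinear.has_vector_derivative [OF bounded_bilinear_col_det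
        has_vector_derivative_u [of t] has_vector_derivative_mat_u [of B t]]
    unfolding has_real_derivative_iff_has_vector_derivative
    by (simp add: Cayley_Hamilton_2)
  have "(?f has_real_derivative 0) (at t)" for t
    by (rule derivative_eq_intros D refl)+ (simp add: algebra_simps)
  then have "?f t = ?f 0"
    by (intro DERIV_isconst_all) auto
  then have "col_det (u t) (B *v u t) = col_det (u 0) (B *v u 0) * exp (trace B * t)"
    by (simp add: exp_minus field_simps)
  also have "col_det (u 0) (B *v u 0) = \<beta> ^ 3"
    unfolding \<beta>_eq u_def by (simp add: odd_real_root_pow)
  also have "\<beta> ^ 3 * exp (trace B * t) = h t ^ 3"
    by (simp add: h_def power_mult_distrib flip: exp_of_nat_mult)
  finally show ?thesis .
qed

lemma u_nonzero: "u t \<noteq> 0"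
proof
  assume "u t = 0"
  then have "h t ^ 3 = 0"
    using col_det_u [of t] by simp
  then show False
    by simp
qed

lemma positively_curved_c: "positively_curved c UNIV"
  by (simp add: positively_curved_def smooth_curve_c curve_deriv_c curve_deriv_u col_det_u)

lemma ea_arc_length_iff:
  "ea_arc_length c UNIV s \<longleftrightarrow> (\<forall>t. (s has_real_derivative h t) (at t))"
  by (simp add: ea_arc_length_def curve_deriv_c curve_deriv_u col_det_u real_root_power_cancel
      less_imp_le)

end

section \<open>Reparametrization by directed arc length\<close>

text \<open>The sign \<open>\<eta>\<close> is the direction in which the arc length is measured.\<close>

locale directed_arc_length = affine_flow +
  fixes s :: "real \<Rightarrow> real" and \<eta> :: real
  assumes \<eta>_cases: "\<eta> = 1 \<or> \<eta> = -1"
    and DERIV_s: "(s has_real_derivative (\<eta> * h t)) (at t)"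
begin

definition T :: "real \<Rightarrow> real" where "T = the_inv_into UNIV s"

lemma \<eta>_square [simp]: "\<eta> * \<eta> = 1" "\<eta> * (\<eta> * x) = x"
  using \<eta>_cases by auto

lemma inj_s: "inj s"
proof (rule linorder_injI)
  fix x y :: real
  assume "x < y"
  then obtain z where "s y - s x = (y - x) * (\<eta> * h z)"
    using MVT2 [of x y s "\<lambda>t. \<eta> * h t"] DERIV_s by auto
  moreover have "(y - x) * (\<eta> * h z) \<noteq> 0"
    using \<open>x < y\<close> \<eta>_cases by auto
  ultimately show "s x \<noteq> s y"
    by auto
qed

lemma T_s [simp]: "T (s t) = t"
  unfolding T_def by (simp add: the_inv_into_f_f inj_s)

lemma continuous_on_s: "continuous_on UNIV s"
  by (rule DERIV_continuous_on) (rule has_field_derivative_at_within [OF DERIV_s])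

text \<open>Derivatives with respect to the arc length are two-sided, so each parameter value needs
  a whole neighbourhood inside the range of \<open>s\<close>.\<close>

lemma open_range_s: "open (range s)"
  using continuous_on_s inj_s by (intro invariance_of_domain) auto

text \<open>The reciprocal of the derivative \<open>\<eta> * h t\<close> of \<open>s\<close> is
  \<open>\<eta> / h t\<close>, as \<open>\<eta>\<close> is its own inverse.\<close>

lemma DERIV_T: "(T has_real_derivative (\<eta> / h t)) (at (s t))"
proof -
  have "(T has_derivative (*) (\<eta> / h t)) (at (s t))"
    by (rule has_derivative_inverse_strong [where S = UNIV and f' = "(*) (\<eta> * h t)"])
      (use DERIV_s [of t] continuous_on_s in \<open>auto simp: has_field_derivative_def fun_eq_iff\<close>)
  then show ?thesis
    by (simp add: has_field_derivative_def)
qed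

text \<open>The chain rule in a form that can be iterated: \<open>f\<close> is known only along
  \<open>s\<close>, through its pullback \<open>q\<close>, and its derivative is again described
  along \<open>s\<close>.\<close>

lemma curve_deriv_reparam:
  assumes f: "\<And>t. f (s t) = q t" and q: "\<And>t. (q has_vector_derivative q' t) (at t)"
  shows "curve_deriv f (s t) = (\<eta> / h t) *\<^sub>R q' t"
proof (rule curve_deriv_eqI, rule has_vector_derivative_transform_within_open)
  show "((q \<circ> T) has_vector_derivative (\<eta> / h t) *\<^sub>R q' t) (at (s t))"
    using DERIV_T [of t] q [of t]
    by (intro vector_diff_chain_at) (simp_all add: has_real_derivative_iff_has_vector_derivative)
qed (use f open_range_s in auto)

lemma DERIV_inverse_h: "((\<lambda>t. 1 / h t) has_real_derivative (- (trace B / 3) / h t)) (at t)"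
  by (rule derivative_eq_intros DERIV_h refl h_nonzero)+ simp

text \<open>Differentiating \<open>1 / h\<close> brings in the logarithmic derivative
  \<open>h' / h = tr B / 3\<close>. In the third derivative, Cayley--Hamilton gives
  \<open>B u\<close> the coefficient \<open>tr B - tr B / 3 - 2 * tr B / 3 = 0\<close>, so that only
  a multiple of \<open>u\<close> survives.\<close>

lemma reparam_derivatives:
  fixes t
  defines "\<gamma> \<equiv> reparam c UNIV s"
  shows "curve_deriv \<gamma> (s t) = (\<eta> / h t) *\<^sub>R u t"
    and "(curve_deriv ^^ 2) \<gamma> (s t) = (1 / (h t)\<^sup>2) *\<^sub>R (B *v u t - (trace B / 3) *\<^sub>R u t)"
    and "(curve_deriv ^^ 3) \<gamma> (s t)
      = (\<eta> * (2 * (trace B)\<^sup>2 / 9 - det B) / h t ^ 3) *\<^sub>R u t"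
proof -
  have 0: "\<gamma> (s t) = c t" for t
    unfolding \<gamma>_def reparam_def by (simp flip: T_def)
  show 1: "curve_deriv \<gamma> (s t) = (\<eta> / h t) *\<^sub>R u t" for t
    by (rule curve_deriv_reparam [OF 0 has_vector_derivative_c])
  have "((\<lambda>t. (\<eta> / h t) *\<^sub>R u t) has_vector_derivative
      (\<eta> / h t) *\<^sub>R (B *v u t - (trace B / 3) *\<^sub>R u t)) (at t)" for t
  proof -
    have "((\<lambda>t. (\<eta> * (1 / h t)) *\<^sub>R u t) has_vector_derivative
        (\<eta> * (1 / h t)) *\<^sub>R (B *v u t) + (\<eta> * (- (trace B / 3) / h t)) *\<^sub>R u t) (at t)"
      by (intro has_vector_derivative_scaleR DERIV_cmult DERIV_inverse_h has_vector_derivative_u)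
    then show ?thesis
      by (simp add: algebra_simps)
  qed
  from curve_deriv_reparam [OF 1 this]
  have 2: "curve_deriv (curve_deriv \<gamma>) (s t)
      = (1 / (h t)\<^sup>2) *\<^sub>R (B *v u t - (trace B / 3) *\<^sub>R u t)" for t
    by (simp add: power2_eq_square)
  then show "(curve_deriv ^^ 2) \<gamma> (s t)
      = (1 / (h t)\<^sup>2) *\<^sub>R (B *v u t - (trace B / 3) *\<^sub>R u t)"
    by (simp add: numeral_2_eq_2)
  have "((\<lambda>t. (1 / (h t)\<^sup>2) *\<^sub>R (B *v u t - (trace B / 3) *\<^sub>R u t)) has_vector_derivative
      ((2 * (trace B)\<^sup>2 / 9 - det B) / (h t)\<^sup>2) *\<^sub>R u t) (at t)" for t
  proof -
    have "((\<lambda>t. (1 / h t) * (1 / h t)) has_real_derivative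
        (- (trace B / 3) / h t) * (1 / h t) + (- (trace B / 3) / h t) * (1 / h t)) (at t)"
      by (intro DERIV_mult DERIV_inverse_h)
    then have "((\<lambda>t. 1 / (h t)\<^sup>2) has_real_derivative (- (2 * trace B / 3) / (h t)\<^sup>2)) (at t)"
      by (simp add: power2_eq_square)
    note D = this
    \<comment> \<open>The scalar multiple of \<open>u\<close> is written as a matrix acting on
      \<open>u\<close>, so that one differentiation rule covers both terms of the
      difference.\<close>
    have e: "((trace B / 3) *\<^sub>R mat 1) *v x = (trace B / 3) *\<^sub>R x" for x :: "real^2"
      by (simp add: scaleR_matrix_vector_assoc [symmetric])
    show ?thesis
      by (rule has_vector_derivative_eq_rhs,
          rule has_vector_derivative_scaleR [OF D has_vector_derivative_diff
            [OF has_vector_derivative_mat_u has_vector_derivative_mat_u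
              [of "(trace B / 3) *\<^sub>R mat 1", unfolded e]]])
        (simp add: Cayley_Hamilton_2 vec_eq_iff power2_eq_square field_simps)
  qed
  from curve_deriv_reparam [OF 2 this]
  show "(curve_deriv ^^ 3) \<gamma> (s t)
      = (\<eta> * (2 * (trace B)\<^sup>2 / 9 - det B) / h t ^ 3) *\<^sub>R u t"
    by (simp add: numeral_3_eq_3 power2_eq_square mult_ac)
qed

lemma third_derivative_reparam:
  "(curve_deriv ^^ 3) (reparam c UNIV s) (s t)
    = - ((det B - 2 * (trace B)\<^sup>2 / 9) / (h t)\<^sup>2) *\<^sub>R curve_deriv (reparam c UNIV s) (s t)"
proof -
  have "\<eta> * (2 * (trace B)\<^sup>2 / 9 - det B) / h t ^ 3
      = - ((det B - 2 * (trace B)\<^sup>2 / 9) / (h t)\<^sup>2) * (\<eta> / h t)"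
    by (simp add: power2_eq_square power3_eq_cube field_simps)
  then show ?thesis
    by (simp only: reparam_derivatives scaleR_scaleR)
qed

lemma ea_curvature_s: "ea_curvature c UNIV s (s t) = (det B - 2 * (trace B)\<^sup>2 / 9) / (h t)\<^sup>2"
  unfolding ea_curvature_def
proof (rule the_equality, rule third_derivative_reparam)
  fix k
  assume "(curve_deriv ^^ 3) (reparam c UNIV s) (s t) = - k *\<^sub>R curve_deriv (reparam c UNIV s) (s t)"
  moreover have "curve_deriv (reparam c UNIV s) (s t) \<noteq> 0"
    using u_nonzero [of t] \<eta>_cases by (auto simp: reparam_derivatives)
  ultimately show "k = (det B - 2 * (trace B)\<^sup>2 / 9) / (h t)\<^sup>2"
    unfolding third_derivative_reparam scaleR_cancel_right by simp
qed

text \<open>Reversing the arc length keeps the second derivative and negates the third, which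
  accounts for the factor \<open>\<eta>\<close>.\<close>

lemma col_det_derivatives_eq_ea_curvature:
  "col_det ((curve_deriv ^^ 2) (reparam c UNIV s) (s t)) ((curve_deriv ^^ 3) (reparam c UNIV s) (s t))
     = \<eta> * ea_curvature c UNIV s (s t)"
  unfolding ea_curvature_s reparam_derivatives
  by (simp add: col_det_swap [of "B *v u t"] col_det_u power2_eq_square power3_eq_cube
      divide_simps) (simp add: algebra_simps)

text \<open>The factor \<open>h\<close> cancels: the square root of the absolute curvature is
  \<open>\<mu> / h\<close> and \<open>s\<close> has derivative \<open>\<eta> * h\<close>, so the
  general-affine arc length has the constant derivative \<open>\<eta> * \<mu>\<close> with respect
  to \<open>t\<close>.\<close>

lemma ga_arc_length_iff:
  assumes "trace B \<noteq> 0" "affine_k B \<noteq> 0"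
  shows "ga_arc_length c UNIV s g \<longleftrightarrow>
    (\<exists>C. \<forall>t. g t = \<eta> * \<bar>trace B\<bar> / (3 * affine_K B) * t + C)"
proof -
  define a where "a = \<bar>affine_k B\<bar>"
  have a: "a > 0"
    using assms by (simp add: a_def)
  define \<mu> where "\<mu> = \<bar>trace B\<bar> / (3 * affine_K B)"
  have \<mu>: "\<mu> = sqrt a * \<bar>trace B\<bar> / 3"
    using a unfolding \<mu>_def affine_K_def a_def [symmetric]
    by (simp add: powr_minus powr_half_sqrt field_simps)
  have k: "det B - 2 * (trace B)\<^sup>2 / 9 = affine_k B * (trace B)\<^sup>2 / 9"
    using assms(1) by (simp add: affine_k_def field_simps)
  have root: "sqrt (abs_ea_curvature c UNIV s (s t)) = \<mu> / h t" for t
  proof -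
    have "abs_ea_curvature c UNIV s (s t) = a * (trace B)\<^sup>2 / 9 / (h t)\<^sup>2"
      unfolding abs_ea_curvature_def ea_curvature_s k by (simp add: a_def abs_mult)
    also have "\<dots> = (\<mu> / h t)\<^sup>2"
      using a by (simp add: \<mu> power_mult_distrib power_divide)
    finally show ?thesis
      using a by (simp add: \<mu> less_imp_le)
  qed
  have "ga_arc_length c UNIV s g \<longleftrightarrow> (\<exists>C. \<forall>t. g t = \<eta> * \<mu> * t + C)"
  proof
    assume "ga_arc_length c UNIV s g"
    then obtain G where G: "\<And>t. (G has_real_derivative \<mu> / h t) (at (s t))" "\<And>t. g t = G (s t)"
      by (auto simp: ga_arc_length_def root)
    have "((\<lambda>t. g t - \<eta> * \<mu> * t) has_real_derivative 0) (at t)" for t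
    proof -
      have "((\<lambda>t. G (s t)) has_real_derivative (\<mu> / h t) * (\<eta> * h t)) (at t)"
        by (rule DERIV_chain2 [OF G(1) DERIV_s])
      then show ?thesis
        unfolding G(2) by (auto intro!: derivative_eq_intros)
    qed
    then have E: "g t - \<eta> * \<mu> * t = g 0 - \<eta> * \<mu> * 0" for t
      by (intro DERIV_isconst_all [of "\<lambda>t. g t - \<eta> * \<mu> * t"]) auto
    have "g t = \<eta> * \<mu> * t + g 0" for t
      using E [of t] by simp
    then show "\<exists>C. \<forall>t. g t = \<eta> * \<mu> * t + C"
      by blast
  next
    assume "\<exists>C. \<forall>t. g t = \<eta> * \<mu> * t + C"
    then obtain C where C: "\<And>t. g t = \<eta> * \<mu> * t + C"
      by blast
    \<comment> \<open>The required function of the arc length is the given affine function of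
      \<open>t\<close>, with \<open>t\<close> recovered by \<open>T\<close>.\<close>
    show "ga_arc_length c UNIV s g"
      unfolding ga_arc_length_def
    proof (intro exI [of _ "\<lambda>\<sigma>. \<eta> * \<mu> * T \<sigma> + C"] conjI ballI)
      fix \<sigma> assume "\<sigma> \<in> range s"
      then obtain t where t: "\<sigma> = s t"
        by blast
      have "((\<lambda>\<sigma>. \<eta> * \<mu> * T \<sigma> + C) has_real_derivative \<eta> * \<mu> * (\<eta> / h t) + 0) (at \<sigma>)"
        unfolding t by (intro DERIV_add DERIV_cmult DERIV_T DERIV_const)
      then show "((\<lambda>\<sigma>. \<eta> * \<mu> * T \<sigma> + C) has_real_derivative sqrt (abs_ea_curvature c UNIV s \<sigma>)) (at \<sigma>)"
        by (simp add: t root mult_ac)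
    qed (simp add: C)
  qed
  then show ?thesis
    by (simp add: \<mu>_def)
qed

text \<open>As \<open>h' = (tr B / 3) * h\<close>, the right-hand side is an antiderivative of
  \<open>\<eta> * h\<close>. The constant \<open>C\<close> is the additive freedom in the choice of
  arc length.\<close>

lemma s_eq:
  assumes "trace B \<noteq> 0"
  obtains C where "\<And>t. s t - C = 3 * \<eta> / trace B * h t"
proof -
  have "((\<lambda>t. s t - 3 * \<eta> / trace B * h t) has_real_derivative 0) (at t)" for t
    by (rule derivative_eq_intros DERIV_s DERIV_h refl)+ (use assms in simp)
  then have E: "s t - 3 * \<eta> / trace B * h t = s 0 - 3 * \<eta> / trace B * h 0" for t
    by (intro DERIV_isconst_all [of "\<lambda>t. s t - 3 * \<eta> / trace B * h t"]) auto
  show thesis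
    by (rule that [of "s 0 - 3 * \<eta> / trace B * h 0"]) (use E in \<open>simp add: algebra_simps\<close>)
qed

text \<open>Expressing \<open>h\<close> by \<open>\<sigma> - C\<close> introduces the factor
  \<open>9 / (tr B)^2\<close>, and this turns \<open>det B - 2 * (tr B)^2 / 9\<close> into
  \<open>k(B)\<close>.\<close>

lemma ea_curvature_eq_inverse_square:
  assumes "trace B \<noteq> 0" "\<And>t. s t - C = 3 * \<eta> / trace B * h t" "\<sigma> \<in> range s"
  shows "ea_curvature c UNIV s \<sigma> = affine_k B / (\<sigma> - C)\<^sup>2"
proof -
  obtain t where t: "\<sigma> = s t"
    using assms(3) by blast
  have "\<eta>\<^sup>2 = 1"
    by (simp add: power2_eq_square)
  then show ?thesis
    unfolding t ea_curvature_s assms(2) affine_k_def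
    using assms(1) by (simp add: power_mult_distrib power_divide field_simps)
qed

text \<open>With \<open>y = \<sigma> - C\<close> the absolute curvature is \<open>a / y^2\<close>,
  with derivative \<open>-2 * a / y^3\<close>, while its power \<open>-3/2\<close> is
  \<open>a powr (-3/2) * \<bar>y\<bar>^3\<close>. The product retains only the sign of
  \<open>y\<close>, which combines the direction \<open>\<eta>\<close> with the sign of the
  trace.\<close>

lemma ga_curvature_s:
  assumes "trace B \<noteq> 0" "affine_k B \<noteq> 0" "\<sigma> \<in> range s"
  shows "ga_curvature c UNIV s \<sigma> = - 2 * (\<eta> * sgn (trace B)) * affine_K B"
proof -
  define a where "a = \<bar>affine_k B\<bar>"
  have a: "a > 0"
    using assms by (simp add: a_def)
  obtain C where C: "\<And>t. s t - C = 3 * \<eta> / trace B * h t"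
    using s_eq [OF assms(1)] by blast
  have k: "abs_ea_curvature c UNIV s x = a / (x - C)\<^sup>2" if "x \<in> range s" for x
    unfolding abs_ea_curvature_def ea_curvature_eq_inverse_square [OF assms(1) C that]
    by (simp add: a_def)
  obtain t where t: "\<sigma> = s t"
    using assms(3) by blast
  define y where "y = \<sigma> - C"
  have y: "y = 3 * \<eta> / trace B * h t"
    by (simp add: y_def t C)
  have sgn_y: "sgn y = \<eta> * sgn (trace B)"
    unfolding y sgn_mult sgn_divide using \<eta>_cases by (auto simp: sgn_if)
  have y0: "y \<noteq> 0"
    using y assms(1) \<eta>_cases by auto
  have "((\<lambda>y. a / y\<^sup>2) has_real_derivative - 2 * a / y ^ 3) (at y)"
    using y0 by (auto intro!: derivative_eq_intros simp: power2_eq_square power3_eq_cube field_simps)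
  from DERIV_chain2 [OF this [unfolded y_def] DERIV_diff [OF DERIV_ident DERIV_const]]
  have "((\<lambda>x. a / (x - C)\<^sup>2) has_real_derivative - 2 * a / y ^ 3) (at \<sigma>)"
    by (simp add: y_def)
  then have "(abs_ea_curvature c UNIV s has_real_derivative - 2 * a / y ^ 3) (at \<sigma>)"
    by (rule has_field_derivative_transform_within_open [OF _ open_range_s assms(3)]) (simp add: k)
  then have D: "deriv (abs_ea_curvature c UNIV s) \<sigma> = - 2 * a / y ^ 3"
    by (rule DERIV_imp_deriv)
  have P: "(a / y\<^sup>2) powr (-3/2) = a powr (-3/2) * \<bar>y\<bar> ^ 3"
  proof -
    have "y\<^sup>2 powr (-3/2) = inverse (\<bar>y\<bar> ^ 3)"
    proof -
      have "y\<^sup>2 = \<bar>y\<bar> powr 2"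
        using y0 by simp
      then have "y\<^sup>2 powr (-3/2) = \<bar>y\<bar> powr (- 3)"
        by (simp only: powr_powr) simp
      then show ?thesis
        using y0 by (simp add: powr_minus)
    qed
    then show ?thesis
      using a by (simp add: powr_divide field_simps)
  qed
  have A: "a * a powr (-3/2) = affine_K B"
    using a powr_add [of a 1 "-3/2"] by (simp add: affine_K_def a_def)
  have "\<bar>y\<bar> ^ 3 = sgn y * y ^ 3"
    by (simp add: sgn_if abs_if power3_eq_cube)
  then have "- 2 * a / y ^ 3 * (a powr (-3/2) * \<bar>y\<bar> ^ 3) = - 2 * sgn y * (a * a powr (-3/2))"
    using y0 by (simp add: field_simps)
  then show ?thesis
    unfolding ga_curvature_def k [OF assms(3)] D y_def [symmetric] P A sgn_y .
qed

end

section \<open>Explicit conics\<close>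

text \<open>Cramer's rule: a continuous function on the plane that reads off the first affine
  coordinate. Its sign later distinguishes the branches or halves of a conic.\<close>

lemma col_det_coordinate:
  assumes "col_det a b \<noteq> 0"
  shows "col_det (p + x *\<^sub>R a + y *\<^sub>R b - p) b / col_det a b = x"
  using assms by simp

lemma continuous_on_col_det_coordinate:
  "continuous_on S (\<lambda>q. col_det (q - p) b / col_det a b)"
  unfolding divide_inverse
  by (intro continuous_intros bounded_bilinear.continuous_on [OF bounded_bilinear_col_det])

context affine_flow
begin

lemma col_det_u_0: "col_det (u 0) (B *v u 0) = \<beta> ^ 3"
  by (simp add: col_det_u) (simp add: h_def)

text \<open>In the frame \<open>u 0\<close>, \<open>B *v u 0\<close> Cayley--Hamilton reduces the
  vector equation to this scalar system, so a closed form of the curve needs only two scalar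
  verifications.\<close>

lemma c_eqI:
  assumes "f1 0 = 0" "f2 0 = 0"
    and f1: "\<And>t. (f1 has_real_derivative 1 - det B * f2 t) (at t)"
    and f2: "\<And>t. (f2 has_real_derivative f1 t + trace B * f2 t) (at t)"
  shows "c = (\<lambda>t. c 0 + f1 t *\<^sub>R u 0 + f2 t *\<^sub>R (B *v u 0))"
proof -
  let ?e = "\<lambda>t. c 0 + f1 t *\<^sub>R u 0 + f2 t *\<^sub>R (B *v u 0)"
  have "(?e has_vector_derivative (B *v ?e t + d)) (at t)" for t
  proof -
    have E: "B *v ?e t + d = u 0 + f1 t *\<^sub>R (B *v u 0) + f2 t *\<^sub>R (B *v (B *v u 0))"
      unfolding matrix_vector_right_distrib matrix_vector_mult_scaleR by (simp add: u_def)
    have "(?e has_vector_derivative (0 + (f1 t *\<^sub>R 0 + (1 - det B * f2 t) *\<^sub>R u 0)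
        + (f2 t *\<^sub>R 0 + (f1 t + trace B * f2 t) *\<^sub>R (B *v u 0)))) (at t)"
      by (intro has_vector_derivative_add has_vector_derivative_scaleR has_vector_derivative_const f1 f2)
    then show ?thesis
      unfolding E Cayley_Hamilton_2 by (rule has_vector_derivative_eq_rhs) (simp add: algebra_simps)
  qed
  then show ?thesis
    by (intro affine_flow_unique [OF flow]) (simp_all add: assms)
qed

lemma range_c_parabola:
  assumes "trace B = 0" "det B = 0"
  shows "parabola (range c)"
proof -
  define p where "p = c 0"
  have c: "c t = p + t *\<^sub>R u 0 + t\<^sup>2 *\<^sub>R ((1/2) *\<^sub>R (B *v u 0))" for t
  proof -
    have "c = (\<lambda>t. c 0 + t *\<^sub>R u 0 + (t\<^sup>2 / 2) *\<^sub>R (B *v u 0))"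
      by (rule c_eqI) (use assms in \<open>auto intro!: derivative_eq_intros\<close>)
    from fun_cong [OF this, of t] show ?thesis
      by (simp add: p_def)
  qed
  have "range c = {p + x *\<^sub>R u 0 + y *\<^sub>R ((1/2) *\<^sub>R (B *v u 0)) | x y. y = x\<^sup>2}"
    by (auto simp: c)
  moreover have "col_det (u 0) ((1/2) *\<^sub>R (B *v u 0)) \<noteq> 0"
    using \<beta>_pos by (simp add: col_det_u_0)
  ultimately show ?thesis
    unfolding parabola_def by blast
qed

lemma range_c_ellipse:
  assumes "trace B = 0" "det B > 0"
  shows "ellipse (range c)"
proof -
  define \<omega> where "\<omega> = sqrt (det B)"
  have \<omega>: "\<omega> > 0" "det B = \<omega>\<^sup>2"
    using assms by (simp_all add: \<omega>_def)
  \<comment> \<open>Since \<open>B^2 = - det B\<close> for vanishing trace, \<open>p\<close> is the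
    stationary point of the flow; it becomes the centre of the ellipse. The coefficient of
    \<open>B *v u 0\<close> obeys the oscillator equation
    \<open>f2'' = 1 - \<omega>^2 * f2\<close>.\<close>
  define p a b where "p = c 0 + (1 / \<omega>\<^sup>2) *\<^sub>R (B *v u 0)"
    and "a = - (1 / \<omega>\<^sup>2) *\<^sub>R (B *v u 0)" and "b = (1 / \<omega>) *\<^sub>R u 0"
  have c: "c t = p + cos (\<omega> * t) *\<^sub>R a + sin (\<omega> * t) *\<^sub>R b" for t
  proof -
    have "c = (\<lambda>t. c 0 + (sin (\<omega> * t) / \<omega>) *\<^sub>R u 0 + ((1 - cos (\<omega> * t)) / \<omega>\<^sup>2) *\<^sub>R (B *v u 0))"
      by (rule c_eqI) (use \<omega> assms(1) in
          \<open>auto intro!: derivative_eq_intros simp: power2_eq_square field_simps\<close>)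
    from fun_cong [OF this, of t] show ?thesis
      by (simp add: p_def a_def b_def diff_divide_distrib algebra_simps)
  qed
  have "range c = {p + x *\<^sub>R a + y *\<^sub>R b | x y. x\<^sup>2 + y\<^sup>2 = 1}"
  proof (intro equalityI subsetI)
    fix q assume "q \<in> {p + x *\<^sub>R a + y *\<^sub>R b | x y. x\<^sup>2 + y\<^sup>2 = 1}"
    then obtain x y where q: "q = p + x *\<^sub>R a + y *\<^sub>R b" "x\<^sup>2 + y\<^sup>2 = 1"
      by blast
    then obtain r where "x = cos r" "y = sin r"
      using sincos_total_2pi by metis
    then have "q = c (r / \<omega>)"
      using \<omega>(1) by (simp add: c q)
    then show "q \<in> range c"
      by simp
  next
    fix q assume "q \<in> range c"
    then obtain t where "q = c t"
      by blast
    then show "q \<in> {p + x *\<^sub>R a + y *\<^sub>R b | x y. x\<^sup>2 + y\<^sup>2 = 1}"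
      using c [of t] sin_cos_squared_add2 [of "\<omega> * t"] by blast
  qed
  moreover have "col_det a b \<noteq> 0"
    using \<beta>_pos \<omega>(1) by (simp add: a_def b_def col_det_swap [of "B *v u 0"] col_det_u_0)
  ultimately show ?thesis
    unfolding ellipse_def by blast
qed

text \<open>As \<open>cosh\<close> is positive, only one branch is traced, and the curve is a
  component of the hyperbola. On the hyperbola \<open>x^2 \<ge> 1\<close>, so the coordinate
  \<open>?X\<close> never vanishes there and, by the intermediate value theorem, no connected subset
  meets both branches.\<close>

lemma range_c_hyperbola_component:
  assumes "trace B = 0" "det B < 0"
  obtains H where "hyperbola H" "range c \<in> components H"
proof -
  define \<omega> where "\<omega> = sqrt (- det B)"
  have \<omega>: "\<omega> > 0" "det B = - \<omega>\<^sup>2"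
    using assms by (simp_all add: \<omega>_def)
  define p a b where "p = c 0 - (1 / \<omega>\<^sup>2) *\<^sub>R (B *v u 0)"
    and "a = (1 / \<omega>\<^sup>2) *\<^sub>R (B *v u 0)" and "b = (1 / \<omega>) *\<^sub>R u 0"
  have c: "c t = p + cosh (\<omega> * t) *\<^sub>R a + sinh (\<omega> * t) *\<^sub>R b" for t
  proof -
    have "c = (\<lambda>t. c 0 + (sinh (\<omega> * t) / \<omega>) *\<^sub>R u 0 + ((cosh (\<omega> * t) - 1) / \<omega>\<^sup>2) *\<^sub>R (B *v u 0))"
      by (rule c_eqI) (use \<omega> assms(1) in
          \<open>auto intro!: derivative_eq_intros simp: power2_eq_square field_simps\<close>)
    from fun_cong [OF this, of t] show ?thesis
      by (simp add: p_def a_def b_def diff_divide_distrib algebra_simps)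
  qed
  define H where "H = {p + x *\<^sub>R a + y *\<^sub>R b | x y. x\<^sup>2 - y\<^sup>2 = 1}"
  have ab: "col_det a b \<noteq> 0"
    using \<beta>_pos \<omega>(1) by (simp add: a_def b_def col_det_swap [of "B *v u 0"] col_det_u_0)
  let ?X = "\<lambda>q. col_det (q - p) b / col_det a b"
  have X: "?X (p + x *\<^sub>R a + y *\<^sub>R b) = x" for x y
    by (rule col_det_coordinate [OF ab])
  have sub: "range c \<subseteq> H"
    using c hyperbolic_pythagoras unfolding H_def by blast
  have sup: "q \<in> range c" if q_H: "q \<in> H" and X_q: "?X q > 0" for q
  proof -
    obtain x y where q: "q = p + x *\<^sub>R a + y *\<^sub>R b" "x\<^sup>2 - y\<^sup>2 = 1"
      using q_H unfolding H_def by blast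
    have "x > 0"
      using X_q unfolding q X .
    \<comment> \<open>On the branch \<open>x > 0\<close> the coordinate \<open>y\<close> determines
      the point, and \<open>arsinh\<close> supplies its parameter.\<close>
    then have "x = sqrt (y\<^sup>2 + 1)"
      using q(2) by (intro real_sqrt_unique [symmetric]) auto
    then have "q = c (arsinh y / \<omega>)"
      using \<omega>(1) by (simp add: c q(1) cosh_arsinh_real)
    then show ?thesis
      by simp
  qed
  have "range c \<in> components H"
    unfolding in_components_maximal
  proof (intro conjI allI impI)
    show "connected (range c)"
      using has_vector_derivative_c
      by (intro connected_continuous_image connected_UNIV)
        (auto intro!: continuous_at_imp_continuous_on has_vector_derivative_continuous)
  next
    fix D assume D: "D \<noteq> {} \<and> range c \<subseteq> D \<and> D \<subseteq> H \<and> connected D"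
    have "q \<in> range c" if "q \<in> D" for q
    proof (rule sup)
      show "q \<in> H"
        using that D by blast
      show "?X q > 0"
      proof (rule ccontr)
        assume "\<not> ?X q > 0"
        have "connected (?X ` D)"
          using D by (intro connected_continuous_image continuous_on_col_det_coordinate) auto
        moreover have "?X q \<in> ?X ` D" "?X (c 0) \<in> ?X ` D"
          using that D by auto
        moreover have "?X (c 0) > 0"
          unfolding c X by simp
        ultimately have "0 \<in> ?X ` D"
          using \<open>\<not> ?X q > 0\<close> connectedD_interval [of "?X ` D" "?X q" "?X (c 0)" 0] by force
        then obtain r where r: "r \<in> H" "?X r = 0"
          using D by force
        then obtain x y where "r = p + x *\<^sub>R a + y *\<^sub>R b" "x\<^sup>2 - y\<^sup>2 = 1"
          unfolding H_def by blast
        with r(2) X [of x y] have "- y\<^sup>2 = 1"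
          by simp
        then show False
          using zero_le_power2 [of y] by linarith
      qed
    qed
    with D show "D = range c"
      by blast
  qed (use sub in auto)
  moreover have "hyperbola H"
    unfolding hyperbola_def H_def using ab by blast
  ultimately show thesis
    using that by blast
qed

text \<open>For \<open>k(B) = 0\<close> the characteristic polynomial has the roots
  \<open>\<mu>\<close> and \<open>2 * \<mu>\<close> with \<open>\<mu> = tr B / 3\<close>. The second
  exponential is the square of the first, which gives a parabola, and positivity of
  \<open>exp\<close> leaves its open half \<open>x > 0\<close>.\<close>

lemma parametrizes_arc_of_parabola:
  assumes "trace B \<noteq> 0" "affine_k B = 0"
  obtains P where "parabola P" "parametrizes_arc_of c UNIV P"
proof -
  define \<mu> where "\<mu> = trace B / 3"
  have \<mu>: "\<mu> \<noteq> 0" "trace B = 3 * \<mu>"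
    using assms(1) by (simp_all add: \<mu>_def)
  have det: "det B = 2 * \<mu>\<^sup>2"
    using assms unfolding affine_k_def \<mu> by (simp add: field_simps)
  define \<nu> where "\<nu> = 1 / \<mu>"
  \<comment> \<open>\<open>p\<close> is the stationary point of the flow, and \<open>a\<close> and
    \<open>b\<close> are the components of \<open>c 0 - p\<close> in the eigenspaces of
    \<open>\<mu>\<close> and \<open>2 * \<mu>\<close>.\<close>
  define p a b where "p = c 0 - (3/2 * \<nu>) *\<^sub>R u 0 + (1/2 * \<nu>\<^sup>2) *\<^sub>R (B *v u 0)"
    and "a = (2 * \<nu>) *\<^sub>R u 0 - \<nu>\<^sup>2 *\<^sub>R (B *v u 0)"
    and "b = (1/2 * \<nu>\<^sup>2) *\<^sub>R (B *v u 0) - (1/2 * \<nu>) *\<^sub>R u 0"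
  have c: "c t = p + exp (\<mu> * t) *\<^sub>R a + (exp (\<mu> * t))\<^sup>2 *\<^sub>R b" for t
  proof -
    let ?E = "\<lambda>t. exp (\<mu> * t)"
    have "c = (\<lambda>t. c 0 + (\<nu> * (- 3/2 + 2 * ?E t - 1/2 * (?E t)\<^sup>2)) *\<^sub>R u 0
        + (\<nu>\<^sup>2 * (1/2 - ?E t + 1/2 * (?E t)\<^sup>2)) *\<^sub>R (B *v u 0))"
      by (rule c_eqI) (use \<mu> det in \<open>auto intro!: derivative_eq_intros
          simp: \<nu>_def power2_eq_square field_simps\<close>)
    from fun_cong [OF this, of t] show ?thesis
      by (simp add: p_def a_def b_def algebra_simps)
  qed
  define P where "P = {p + x *\<^sub>R a + y *\<^sub>R b | x y. y = x\<^sup>2}"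
  have "col_det a b = 1/2 * \<nu> ^ 3 * \<beta> ^ 3"
    by (simp add: a_def b_def col_det_swap [of "B *v u 0"] col_det_u_0 power2_eq_square
        power3_eq_cube)
  then have ab: "col_det a b \<noteq> 0"
    using \<beta>_pos \<mu>(1) by (auto simp: \<nu>_def)
  let ?X = "\<lambda>q. col_det (q - p) b / col_det a b"
  have X: "?X (p + x *\<^sub>R a + y *\<^sub>R b) = x" for x y
    by (rule col_det_coordinate [OF ab])
  have Xc: "?X (c t) = exp (\<mu> * t)" for t
    unfolding c X ..
  have "range c = P \<inter> ?X -` {0<..}"
  proof (intro equalityI subsetI)
    fix q assume "q \<in> range c"
    then obtain t where t: "q = c t"
      by blast
    have "q \<in> P"
      unfolding P_def t using c [of t] by blast
    moreover have "?X q > 0"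
      unfolding t Xc by simp
    ultimately show "q \<in> P \<inter> ?X -` {0<..}"
      by simp
  next
    fix q assume q: "q \<in> P \<inter> ?X -` {0<..}"
    then obtain x where x: "q = p + x *\<^sub>R a + x\<^sup>2 *\<^sub>R b"
      unfolding P_def by blast
    have "?X q > 0"
      using q by simp
    then have "x > 0"
      unfolding x X .
    then have "q = c (ln x / \<mu>)"
      using \<mu>(1) by (simp add: c x)
    then show "q \<in> range c"
      by simp
  qed
  moreover have "openin (top_of_set P) (P \<inter> ?X -` {0<..})"
    by (intro continuous_openin_preimage_gen continuous_on_col_det_coordinate) auto
  moreover have "inj c"
  proof (rule injI)
    fix t t' assume "c t = c t'"
    then have "exp (\<mu> * t) = exp (\<mu> * t')"
      using Xc by metis
    then show "t = t'"
      using \<mu>(1) by simp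
  qed
  ultimately have "parametrizes_arc_of c UNIV P"
    by (simp add: parametrizes_arc_of_def smooth_curve_c curve_deriv_c u_nonzero)
  moreover have "parabola P"
    unfolding parabola_def P_def using ab by blast
  ultimately show thesis
    using that by blast
qed

section \<open>Choice of arc length and the affine invariants\<close>

lemma directed_arc_length_1:
  "ea_arc_length c UNIV s \<Longrightarrow> directed_arc_length B d c \<beta> s 1"
  by unfold_locales (simp_all add: ea_arc_length_iff)

text \<open>Here the arc length runs in the direction in which \<open>h\<close> grows, so that, up
  to an additive constant, it is a positive multiple of \<open>h\<close>.\<close>

lemma directed_arc_length_sgn:
  assumes "trace B \<noteq> 0" "ea_arc_length c UNIV (\<lambda>t. sgn (trace B) * s t)"
  shows "directed_arc_length B d c \<beta> s (sgn (trace B))"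
proof unfold_locales
  show "sgn (trace B) = 1 \<or> sgn (trace B) = - 1"
    using assms(1) by (simp add: sgn_if)
  show "(s has_real_derivative sgn (trace B) * h t) (at t)" for t
  proof -
    have "((\<lambda>t. sgn (trace B) * (sgn (trace B) * s t)) has_real_derivative sgn (trace B) * h t) (at t)"
      using assms(2) unfolding ea_arc_length_iff by (intro DERIV_cmult) auto
    moreover have "sgn (trace B) * (sgn (trace B) * s t) = s t" for t
      using assms(1) by (simp add: sgn_if)
    ultimately show ?thesis
      by (simp only:)
  qed
qed

lemma DERIV_normalized_arc_length:
  assumes "trace B \<noteq> 0"
  shows "((\<lambda>t. 3 * \<eta> / trace B * h t) has_real_derivative \<eta> * h t) (at t)"
  by (rule derivative_eq_intros DERIV_h refl)+ (use assms in simp)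

text \<open>This is the inverse square law with additive constant 0.\<close>

lemma ea_curvature_normalized_arc_length:
  assumes "trace B \<noteq> 0" "\<eta> = 1 \<or> \<eta> = -1" "\<sigma> \<in> range (\<lambda>t. 3 * \<eta> / trace B * h t)"
  shows "ea_curvature c UNIV (\<lambda>t. 3 * \<eta> / trace B * h t) \<sigma> = affine_k B * \<sigma> powi (- 2)"
proof -
  interpret directed_arc_length B d c \<beta> "\<lambda>t. 3 * \<eta> / trace B * h t" \<eta>
    using assms(2) DERIV_normalized_arc_length [OF assms(1)] by unfold_locales auto
  show ?thesis
    using ea_curvature_eq_inverse_square [OF assms(1) _ assms(3), of 0]
    by (simp add: power_int_minus divide_inverse)
qed

lemma ea_curvature_trace_0:
  assumes "trace B = 0" "ea_arc_length c UNIV s" "\<sigma> \<in> range s"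
  shows "ea_curvature c UNIV s \<sigma> = det B / \<beta>\<^sup>2"
proof -
  interpret directed_arc_length B d c \<beta> s 1
    by (rule directed_arc_length_1 [OF assms(2)])
  show ?thesis
    using assms(1,3) by (auto simp: ea_curvature_s h_def)
qed

lemma ea_curvature_eq_0:
  assumes "trace B \<noteq> 0" "affine_k B = 0" "ea_arc_length c UNIV s" "\<sigma> \<in> range s"
  shows "ea_curvature c UNIV s \<sigma> = 0"
proof -
  interpret directed_arc_length B d c \<beta> s 1
    by (rule directed_arc_length_1 [OF assms(3)])
  obtain C where "\<And>t. s t - C = 3 * 1 / trace B * h t"
    using s_eq [OF assms(1)] by blast
  from ea_curvature_eq_inverse_square [OF assms(1) this assms(4)] show ?thesis
    using assms(2) by simp
qed

lemma ea_arc_length_trace_0: "trace B = 0 \<Longrightarrow> ea_arc_length c UNIV (\<lambda>t. \<beta> * t)"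
  by (auto simp: ea_arc_length_iff h_def intro!: derivative_eq_intros)

text \<open>The curvature has the constant sign of \<open>k(B)\<close>, because
  \<open>\<sigma> powi (- 2)\<close> is positive along the normalized arc length.\<close>

lemma ga_defined_c:
  assumes "trace B \<noteq> 0" "affine_k B \<noteq> 0"
  shows "ga_defined c UNIV"
  unfolding ga_defined_def has_ea_sign_def
proof (intro conjI positively_curved_c exI ballI)
  let ?s = "\<lambda>t. 3 * 1 / trace B * h t"
  show "sgn (affine_k B) \<noteq> 0"
    using assms(2) by (simp add: sgn_eq_0_iff)
  show "ea_arc_length c UNIV ?s"
    using DERIV_normalized_arc_length [OF assms(1), of 1] by (simp add: ea_arc_length_iff)
  fix \<sigma> assume \<sigma>: "\<sigma> \<in> range ?s"
  then have "\<sigma> \<noteq> 0"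
    using assms(1) by auto
  then have "\<sigma> powi (- 2) > 0"
    by (simp add: power_int_minus)
  from sgn_pos [OF this] show "sgn (ea_curvature c UNIV ?s \<sigma>) = sgn (affine_k B)"
    unfolding ea_curvature_normalized_arc_length [OF assms(1) disjI1 [OF refl] \<sigma>] sgn_mult by simp
qed

lemma proportional_to_ga_arc_length_c:
  assumes "trace B \<noteq> 0" "affine_k B \<noteq> 0"
  shows "proportional_to_ga_arc_length c UNIV"
proof -
  let ?s = "\<lambda>t. 3 * 1 / trace B * h t" and ?m = "\<bar>trace B\<bar> / (3 * affine_K B)"
  have s: "ea_arc_length c UNIV ?s"
    using DERIV_normalized_arc_length [OF assms(1), of 1] by (simp add: ea_arc_length_iff)
  then interpret directed_arc_length B d c \<beta> ?s 1
    by (rule directed_arc_length_1)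
  have "ga_arc_length c UNIV ?s (\<lambda>t. ?m * t)"
    unfolding ga_arc_length_iff [OF assms] by (intro exI [of _ 0]) simp
  \<comment> \<open>\<open>affine_K B\<close> is a real power of a non-zero number and hence
    non-zero itself.\<close>
  moreover have "?m \<noteq> 0"
    using assms by (simp add: affine_K_def)
  then have "1 / ?m \<noteq> 0" "\<forall>t\<in>UNIV. t = 1 / ?m * (?m * t) + 0"
    by simp_all
  ultimately show ?thesis
    unfolding proportional_to_ga_arc_length_def using s by blast
qed

end

text \<open>The formulas \<open>-2 * K\<close> and \<open>tr B * t / (3 * K)\<close> refer to an arc
  length that can be chosen positive; for negative trace it decreases in \<open>t\<close>. They are
  therefore stated for this direction and, with adjusted signs, for the increasing one. The law
  \<open>k * \<sigma> powi (-2)\<close> fixes the additive constant and is existential in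
  \<open>s\<close>, whereas constant curvatures are asserted for every admissible
  \<open>s\<close>.\<close>

theorem proposition2:
  fixes B :: "real^2^2" and d v :: "real^2" and c :: "real \<Rightarrow> real^2" and \<beta> :: real
  assumes "B \<noteq> 0"
    and "\<not> eigenvector_of B (B *v v + d)"
    and "\<And>t. (c has_vector_derivative (B *v c t + d)) (at t)"
    and "c 0 = v"
    and "\<beta> = root 3 (col_det (B *v v + d) (B *v (B *v v + d)))"
    and "\<beta> > 0"
  shows
    "(\<forall>t. c t = v + F_mat B t *v (B *v v + d) \<and>
          c t = mat_exp (t *\<^sub>R B) *v v + F_mat B t *v d) \<and>
     \<beta> = root 3 (col_det (curve_deriv c 0) (curve_deriv (curve_deriv c) 0)) \<and>
     positively_curved c UNIV \<and>
     (\<forall>s. ea_arc_length c UNIV s \<longrightarrow> (\<forall>\<sigma>\<in>range s.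
        (let \<gamma> = reparam c UNIV s in
          (curve_deriv ^^ 3) \<gamma> \<sigma> = - ea_curvature c UNIV s \<sigma> *\<^sub>R curve_deriv \<gamma> \<sigma> \<and>
          ea_curvature c UNIV s \<sigma> = col_det ((curve_deriv ^^ 2) \<gamma> \<sigma>) ((curve_deriv ^^ 3) \<gamma> \<sigma>)))) \<and>

     (trace B = 0 \<longrightarrow>
        proportional_to_ea_arc_length c UNIV \<and>
        (\<forall>s. ea_arc_length c UNIV s \<longrightarrow>
           (\<forall>\<sigma>\<in>range s. ea_curvature c UNIV s \<sigma> = det B / \<beta>\<^sup>2)) \<and>
        (\<exists>\<epsilon>. has_ea_sign c UNIV \<epsilon> \<and> \<epsilon> = sgn (det B) \<and>
           (\<epsilon> = 0 \<longrightarrow> parabola (range c)) \<and>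
           (\<epsilon> > 0 \<longrightarrow> ellipse (range c)) \<and>
           (\<epsilon> < 0 \<longrightarrow> (\<exists>H. hyperbola H \<and> range c \<in> components H)))) \<and>

     (trace B \<noteq> 0 \<longrightarrow>
        (\<exists>s. ea_arc_length c UNIV s \<and>
           (\<forall>\<sigma>\<in>range s. \<sigma> \<noteq> 0 \<and> ea_curvature c UNIV s \<sigma> = affine_k B * \<sigma> powi (-2))) \<and>
        (affine_k B = 0 \<longrightarrow>
           (\<forall>s. ea_arc_length c UNIV s \<longrightarrow> (\<forall>\<sigma>\<in>range s. ea_curvature c UNIV s \<sigma> = 0)) \<and>
           (\<exists>P. parabola P \<and> parametrizes_arc_of c UNIV P)) \<and>
        (affine_k B \<noteq> 0 \<longrightarrow>
           ga_defined c UNIV \<and>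
           \<comment> \<open>equi-affine arc length directed so that it can be chosen positive\<close>
           (\<exists>s. ea_arc_length c UNIV (\<lambda>t. sgn (trace B) * s t) \<and>
              (\<forall>\<sigma>\<in>range s. \<sigma> > 0 \<and> ea_curvature c UNIV s \<sigma> = affine_k B * \<sigma> powi (-2))) \<and>
           (\<forall>s. ea_arc_length c UNIV (\<lambda>t. sgn (trace B) * s t) \<longrightarrow>
              (\<forall>\<sigma>\<in>range s. ga_curvature c UNIV s \<sigma> = -2 * affine_K B) \<and>
              (\<forall>g. ga_arc_length c UNIV s g \<longleftrightarrow>
                 (\<exists>C. \<forall>t. g t = trace B / (3 * affine_K B) * t + C))) \<and>
           \<comment> \<open>equi-affine arc length increasing with \<open>t\<close>\<close>
           (\<forall>s. ea_arc_length c UNIV s \<longrightarrow>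
              (\<forall>\<sigma>\<in>range s. ga_curvature c UNIV s \<sigma> = -2 * sgn (trace B) * affine_K B) \<and>
              (\<forall>g. ga_arc_length c UNIV s g \<longleftrightarrow>
                 (\<exists>C. \<forall>t. g t = \<bar>trace B\<bar> / (3 * affine_K B) * t + C))) \<and>
           proportional_to_ga_arc_length c UNIV))"
proof -
  interpret affine_flow B d c \<beta>
    using assms by unfold_locales auto
  have u_0: "B *v v + d = u 0"
    by (simp add: u_def assms(4))
  have solution: "c t = v + F_mat B t *v (B *v v + d)" for t
    using affine_flow_solution [OF assms(3), of t] assms(4) by simp
  have exp_solution: "c t = mat_exp (t *\<^sub>R B) *v v + F_mat B t *v d" for t
    unfolding solution mat_exp_eq_F_mat by (simp add: matrix_vector_right_distrib)
  have \<beta>: "\<beta> = root 3 (col_det (curve_deriv c 0) (curve_deriv (curve_deriv c) 0))"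
    using assms(5) by (simp add: curve_deriv_c curve_deriv_u u_0)
  have curvature: "\<forall>s. ea_arc_length c UNIV s \<longrightarrow> (\<forall>\<sigma>\<in>range s.
        (let \<gamma> = reparam c UNIV s in
          (curve_deriv ^^ 3) \<gamma> \<sigma> = - ea_curvature c UNIV s \<sigma> *\<^sub>R curve_deriv \<gamma> \<sigma> \<and>
          ea_curvature c UNIV s \<sigma> = col_det ((curve_deriv ^^ 2) \<gamma> \<sigma>) ((curve_deriv ^^ 3) \<gamma> \<sigma>)))"
  proof (intro allI impI)
    fix s assume "ea_arc_length c UNIV s"
    then interpret directed_arc_length B d c \<beta> s 1
      by (rule directed_arc_length_1)
    show "\<forall>\<sigma>\<in>range s. (let \<gamma> = reparam c UNIV s in
          (curve_deriv ^^ 3) \<gamma> \<sigma> = - ea_curvature c UNIV s \<sigma> *\<^sub>R curve_deriv \<gamma> \<sigma> \<and>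
          ea_curvature c UNIV s \<sigma> = col_det ((curve_deriv ^^ 2) \<gamma> \<sigma>) ((curve_deriv ^^ 3) \<gamma> \<sigma>))"
      unfolding Let_def
      using third_derivative_reparam col_det_derivatives_eq_ea_curvature
      by (auto simp only: ea_curvature_s mult_1)
  qed
  have a1: "proportional_to_ea_arc_length c UNIV" if "trace B = 0"
    unfolding proportional_to_ea_arc_length_def
    using ea_arc_length_trace_0 [OF that] assms(6)
    by (intro exI [of _ "\<lambda>t. \<beta> * t"] exI [of _ "1 / \<beta>"] exI [of _ 0]) auto
  have a2: "has_ea_sign c UNIV (sgn (det B))" if "trace B = 0"
    unfolding has_ea_sign_def
    using ea_arc_length_trace_0 [OF that] ea_curvature_trace_0 [OF that] assms(6)
    by (intro exI [of _ "\<lambda>t. \<beta> * t"]) (auto simp: sgn_divide)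
  have a3: "\<exists>\<epsilon>. has_ea_sign c UNIV \<epsilon> \<and> \<epsilon> = sgn (det B) \<and>
           (\<epsilon> = 0 \<longrightarrow> parabola (range c)) \<and>
           (\<epsilon> > 0 \<longrightarrow> ellipse (range c)) \<and>
           (\<epsilon> < 0 \<longrightarrow> (\<exists>H. hyperbola H \<and> range c \<in> components H))" if "trace B = 0"
    using a2 [OF that] range_c_parabola [OF that] range_c_ellipse [OF that]
      range_c_hyperbola_component [OF that]
    by (intro exI [of _ "sgn (det B)"]) (auto simp: sgn_eq_0_iff)
  have b1: "\<exists>s. ea_arc_length c UNIV s \<and>
           (\<forall>\<sigma>\<in>range s. \<sigma> \<noteq> 0 \<and> ea_curvature c UNIV s \<sigma> = affine_k B * \<sigma> powi (-2))"
    if "trace B \<noteq> 0"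
  proof (intro exI conjI ballI)
    let ?s = "\<lambda>t. 3 * 1 / trace B * h t"
    show "ea_arc_length c UNIV ?s"
      using DERIV_normalized_arc_length [OF that, of 1] by (simp add: ea_arc_length_iff)
    fix \<sigma> assume \<sigma>: "\<sigma> \<in> range ?s"
    show "\<sigma> \<noteq> 0"
      using \<sigma> that by auto
    show "ea_curvature c UNIV ?s \<sigma> = affine_k B * \<sigma> powi (-2)"
      by (rule ea_curvature_normalized_arc_length [OF that _ \<sigma>]) simp
  qed
  have b2: "\<exists>s. ea_arc_length c UNIV (\<lambda>t. sgn (trace B) * s t) \<and>
              (\<forall>\<sigma>\<in>range s. \<sigma> > 0 \<and> ea_curvature c UNIV s \<sigma> = affine_k B * \<sigma> powi (-2))"
    if "trace B \<noteq> 0"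
  proof (intro exI conjI ballI)
    \<comment> \<open>The coefficient equals \<open>3 / \<bar>tr B\<bar>\<close>, which makes this
      parameter positive for either sign of the trace.\<close>
    let ?s = "\<lambda>t. 3 * sgn (trace B) / trace B * h t"
    have e: "sgn (trace B) * ?s t = 3 * 1 / trace B * h t" for t
      using that by (simp add: sgn_if)
    show "ea_arc_length c UNIV (\<lambda>t. sgn (trace B) * ?s t)"
      unfolding e ea_arc_length_iff using DERIV_normalized_arc_length [OF that, of 1] by simp
    fix \<sigma> assume \<sigma>: "\<sigma> \<in> range ?s"
    have "sgn (trace B) / trace B > 0"
      using that by (simp add: sgn_if)
    then have "3 * (sgn (trace B) / trace B) * h t > 0" for t
      by (intro mult_pos_pos h_pos) simp_all
    then show "\<sigma> > 0"
      using \<sigma> by (auto simp only: times_divide_eq_right)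
    show "ea_curvature c UNIV ?s \<sigma> = affine_k B * \<sigma> powi (-2)"
      by (rule ea_curvature_normalized_arc_length [OF that _ \<sigma>]) (use that in \<open>simp add: sgn_if\<close>)
  qed
  have b3: "(\<forall>\<sigma>\<in>range s. ga_curvature c UNIV s \<sigma> = -2 * affine_K B) \<and>
      (\<forall>g. ga_arc_length c UNIV s g \<longleftrightarrow> (\<exists>C. \<forall>t. g t = trace B / (3 * affine_K B) * t + C))"
    if tr: "trace B \<noteq> 0" "affine_k B \<noteq> 0" and s: "ea_arc_length c UNIV (\<lambda>t. sgn (trace B) * s t)" for s
  proof -
    interpret directed_arc_length B d c \<beta> s "sgn (trace B)"
      by (rule directed_arc_length_sgn [OF tr(1) s])
    \<comment> \<open>With \<open>\<eta> = sgn (trace B)\<close> this identity removes the absolute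
      value from the general-affine speed.\<close>
    have "sgn (trace B) * \<bar>trace B\<bar> = trace B"
      by (rule sgn_mult_abs)
    then show ?thesis
      unfolding ga_arc_length_iff [OF tr] using ga_curvature_s [OF tr] tr(1) by simp
  qed
  have b4: "(\<forall>\<sigma>\<in>range s. ga_curvature c UNIV s \<sigma> = -2 * sgn (trace B) * affine_K B) \<and>
      (\<forall>g. ga_arc_length c UNIV s g \<longleftrightarrow> (\<exists>C. \<forall>t. g t = \<bar>trace B\<bar> / (3 * affine_K B) * t + C))"
    if tr: "trace B \<noteq> 0" "affine_k B \<noteq> 0" and s: "ea_arc_length c UNIV s" for s
  proof -
    interpret directed_arc_length B d c \<beta> s 1
      by (rule directed_arc_length_1 [OF s])
    show ?thesis
      unfolding ga_arc_length_iff [OF tr] using ga_curvature_s [OF tr] by simp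
  qed
  have b5: "\<exists>P. parabola P \<and> parametrizes_arc_of c UNIV P" if "trace B \<noteq> 0" "affine_k B = 0"
    using parametrizes_arc_of_parabola [OF that] by blast
  show ?thesis
    apply (intro conjI allI impI)
    subgoal by (rule solution)
    subgoal by (rule exp_solution)
    subgoal by (rule \<beta>)
    subgoal by (rule positively_curved_c)
    subgoal using curvature by blast
    subgoal by (rule a1)
    subgoal using ea_curvature_trace_0 by blast
    subgoal by (rule a3)
    subgoal by (rule b1)
    subgoal using ea_curvature_eq_0 by blast
    subgoal by (rule b5)
    subgoal by (rule ga_defined_c)
    subgoal by (rule b2)
    subgoal using b3 by blast
    subgoal using b3 by blast
    subgoal using b4 by blast
    subgoal using b4 by blast
    subgoal by (rule proportional_to_ga_arc_length_c)
    done
qed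

end
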